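(* Let $X$ be a real Hilbert space, $T$ a bounded, self-adjoint, invertible linear operator on $X$, and $X_0\subset X_1\subset\cdots$ nested finite-dimensional subspaces of $X$, not all $\{0\}$, whose compressions $T_\ell$ of $T$ are uniformly invertible, i.e. $\beta_d:=\inf_{\ell\ge0}\|T_\ell^{-1}\|^{-1}>0$. Let $G_\ell$ be the Galerkin projections, $K=\sup_{\ell\ge0}\|G_\ell\|<\infty$, $\vartheta_K=\sqrt{1-K^{-2}}$, $\sigma_K=\log_2(1+\vartheta_K)$, let $Y_j$ be the detail spaces, $B_j$ the local compressions, $\mu=\inf_j\|B_j^{-1}\|^{-1}$, and for a consecutive interval $I$ of $n=|I|\geq 1$ detail levels let $\mathfrak{J}_I$ be the finite-window sign operator on $Y_I=\bigoplus_{j\in I}Y_j$. Then $$\|\mathfrak{J}_I\|_{\mathcal{L}(Y_I)}\le 2K(1+\vartheta_K)\,n^{\sigma_K}.$$ Moreover, for $w=\sum_{j\in I}y_j$ with $y_j\in Y_j$, $$\sum_{j\in I}\|y_j\|_X^2\le\frac{2\|T\|K(1+\vartheta_K)}{\mu}\,n^{\sigma_K}\,\|w\|_X^2.$$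
   Context: Let $a(x,y):=(Tx,y)_X$. $Q_\ell$ is the orthogonal projector of $X$ onto $X_\ell$ and $T_\ell:=Q_\ell T|_{X_\ell}:X_\ell\to X_\ell$. The Galerkin projection $G_\ell:X\to X_\ell$ is defined by $a(G_\ell x,y)=a(x,y)$ for all $y\in X_\ell$; equivalently $G_\ell=T_\ell^{-1}Q_\ell T$. These satisfy $G_jG_k=G_{\min\{j,k\}}$ and $K\le\|T\|/\beta_d<\infty$. Set $G_{-1}:=0$ and $Y_j:=\operatorname{ran}(G_j-G_{j-1})$ for $j\ge0$ (detail levels). Finite sums of distinct $Y_j$ are algebraically direct; indices with $Y_j=\{0\}$ may be omitted (in particular, they are disregarded in the infimum defining $\mu$; likewise levels with $X_\ell=\{0\}$ are disregarded in the infimum defining $\beta_d$). Let $Q_{Y_j}$ be the orthogonal projector onto $Y_j$, and $B_j:=Q_{Y_j}T|_{Y_j}:Y_j\to Y_j$. Each $B_j$ is self-adjoint and invertible, and $\mu:=\inf_j\|B_j^{-1}\|^{-1}>0$. Let $R_j:=\operatorname{sgn}(B_j)$ (spectral functional calculus: $+1$ on eigenspaces with positive eigenvalue, $-1$ on eigenspaces with negative eigenvalue). For a finite consecutive interval $I$ of indices, $Y_I:=\bigoplus_{j\in I}Y_j$ carries the norm inherited from $X$, and $\mathfrak{J}_I\bigl(\sum_{j\in I}y_j\bigr):=\sum_{j\in I}R_jy_j$ for $y_j\in Y_j$. *)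

theory Defs
  imports "HOL-Analysis.Analysis"
begin

definition fin_dim_subspace :: "'a::real_vector set \<Rightarrow> bool" where
  "fin_dim_subspace S \<longleftrightarrow> (\<exists>B. finite B \<and> S = span B)"

definition self_adjoint :: "('a::real_inner \<Rightarrow> 'a) \<Rightarrow> bool" where
  "self_adjoint T \<longleftrightarrow> (\<forall>x y. T x \<bullet> y = x \<bullet> T y)"

text \<open>Operator norm of a map restricted to a subspace; the point 0 contributes the
  value \<open>0 / 0 = 0\<close>, so the norm on the zero space is 0.\<close>
definition onorm_on :: "'a::real_normed_vector set \<Rightarrow> ('a \<Rightarrow> 'a) \<Rightarrow> real" where
  "onorm_on S f = (SUP x\<in>S. norm (f x) / norm x)"

definition orth_proj :: "'a::real_inner set \<Rightarrow> 'a \<Rightarrow> 'a" where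
  "orth_proj S x = (THE p. p \<in> S \<and> (\<forall>y\<in>S. (x - p) \<bullet> y = 0))"

text \<open>Only the values on \<open>S\<close> are meaningful: this stands for an operator \<open>S \<rightarrow> S\<close>.\<close>
definition compression :: "('a::real_inner \<Rightarrow> 'a) \<Rightarrow> 'a set \<Rightarrow> 'a \<Rightarrow> 'a" where
  "compression T S x = orth_proj S (T x)"

text \<open>\<open>inf\<^sub>j \<parallel>C\<^sub>j\<^sup>-\<^sup>1\<parallel>\<^sup>-\<^sup>1\<close> for the compressions \<open>C\<^sub>j\<close> of \<open>T\<close> to \<open>V\<^sub>j\<close>, disregarding the
  indices with \<open>V\<^sub>j = {0}\<close>. With \<open>V\<close> the given subspaces this is \<open>\<beta>\<^sub>d\<close>, with \<open>V\<close> the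
  detail spaces it is \<open>\<mu>\<close>.\<close>
definition inf_sup_const :: "('a::real_inner \<Rightarrow> 'a) \<Rightarrow> (nat \<Rightarrow> 'a set) \<Rightarrow> real" where
  "inf_sup_const T V =
     (INF j\<in>{j. V j \<noteq> {0}}. inverse (onorm_on (V j) (inv_into (V j) (compression T (V j)))))"

definition galerkin :: "('a::real_inner \<Rightarrow> 'a) \<Rightarrow> 'a set \<Rightarrow> 'a \<Rightarrow> 'a" where
  "galerkin T S x = (THE g. g \<in> S \<and> (\<forall>y\<in>S. T g \<bullet> y = T x \<bullet> y))"

definition galerkin_const :: "('a::real_inner \<Rightarrow> 'a) \<Rightarrow> (nat \<Rightarrow> 'a set) \<Rightarrow> real" where
  "galerkin_const T X = (SUP l. onorm (galerkin T (X l)))"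

definition theta_const :: "real \<Rightarrow> real" where
  "theta_const K = sqrt (1 - 1 / K ^ 2)"

definition sigma_const :: "real \<Rightarrow> real" where
  "sigma_const K = log 2 (1 + theta_const K)"

definition detail_space :: "('a::real_inner \<Rightarrow> 'a) \<Rightarrow> (nat \<Rightarrow> 'a set) \<Rightarrow> nat \<Rightarrow> 'a set" where
  "detail_space T X j =
     range (\<lambda>x. galerkin T (X j) x - (if j = 0 then 0 else galerkin T (X (j - 1)) x))"

definition eigenspace_on :: "'a::real_vector set \<Rightarrow> ('a \<Rightarrow> 'a) \<Rightarrow> real \<Rightarrow> 'a set" where
  "eigenspace_on S B c = {v \<in> S. B v = c *\<^sub>R v}"

text \<open>Spectral functional calculus \<open>f(B) = \<Sum>\<^sub>c f(c) P\<^sub>c\<close> for a self-adjoint operator \<open>B\<close> on a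
  finite-dimensional space \<open>S\<close>, with \<open>c\<close> ranging over the (finitely many) eigenvalues and
  \<open>P\<^sub>c\<close> the orthogonal projector onto the eigenspace.\<close>
definition spectral_apply :: "(real \<Rightarrow> real) \<Rightarrow> 'a::real_inner set \<Rightarrow> ('a \<Rightarrow> 'a) \<Rightarrow> 'a \<Rightarrow> 'a" where
  "spectral_apply f S B x =
     (\<Sum>c\<in>{c. eigenspace_on S B c \<noteq> {0}}. f c *\<^sub>R orth_proj (eigenspace_on S B c) x)"

definition local_sign :: "('a::real_inner \<Rightarrow> 'a) \<Rightarrow> (nat \<Rightarrow> 'a set) \<Rightarrow> nat \<Rightarrow> 'a \<Rightarrow> 'a" where
  "local_sign T X j =
     spectral_apply sgn (detail_space T X j) (compression T (detail_space T X j))"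

definition window_space :: "('a::real_inner \<Rightarrow> 'a) \<Rightarrow> (nat \<Rightarrow> 'a set) \<Rightarrow> nat set \<Rightarrow> 'a set" where
  "window_space T X I = {\<Sum>j\<in>I. y j | y. \<forall>j\<in>I. y j \<in> detail_space T X j}"

text \<open>The value at \<open>w\<close> is determined because the sum of the detail spaces is direct.\<close>
definition window_sign :: "('a::real_inner \<Rightarrow> 'a) \<Rightarrow> (nat \<Rightarrow> 'a set) \<Rightarrow> nat set \<Rightarrow> 'a \<Rightarrow> 'a" where
  "window_sign T X I w =
     (THE v. \<exists>y. (\<forall>j\<in>I. y j \<in> detail_space T X j) \<and> w = (\<Sum>j\<in>I. y j) \<and>
                 v = (\<Sum>j\<in>I. local_sign T X j (y j)))"

text \<open>Finite consecutive intervals of detail levels. Since indices with trivial detail space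
  may be omitted from the numbering, gaps are allowed exactly at such indices; in
  particular every interval \<open>{a..b}\<close> with \<open>a \<le> b\<close> qualifies.\<close>
definition detail_window :: "('a::real_inner \<Rightarrow> 'a) \<Rightarrow> (nat \<Rightarrow> 'a set) \<Rightarrow> nat set \<Rightarrow> bool" where
  "detail_window T X I \<longleftrightarrow> finite I \<and> I \<noteq> {} \<and>
     (\<forall>i\<in>I. \<forall>k\<in>I. \<forall>j. i \<le> j \<and> j \<le> k \<and> detail_space T X j \<noteq> {0} \<longrightarrow> j \<in> I)"

end

theory Submission
  imports Defs
begin

text \<open>
  Write \<open>D\<^sub>j = G\<^sub>j - G\<^sub>j\<^sub>-\<^sub>1\<close> for the projection onto the detail space \<open>Y\<^sub>j\<close>, \<open>J\<close> for
  the window sign operator and \<open>\<theta>\<close> for \<open>\<theta>\<^sub>K\<close>. The decomposition \<open>w = \<Sum>\<^sub>j y\<^sub>j\<close> is orthogonal up to a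
  factor growing slowly with the number \<open>n\<close> of levels. If it were exactly orthogonal, \<open>J\<close> would be
  an isometry, because each \<open>R\<^sub>j\<close> is an isometry of \<open>Y\<^sub>j\<close>; in general \<open>\<parallel>J\<parallel>\<close> is at most the product
  of the constants in the upper and lower square-sum estimates.

  The Galerkin projection \<open>G\<^sub>m\<close> fixes the \<open>Y\<^sub>j\<close> with \<open>j \<le> m\<close>, kills the others, and has norm at
  most \<open>K\<close>. A projection of norm at most \<open>K\<close> keeps its range and its kernel at an angle of cosine
  at most \<open>\<theta>\<close> (\<open>inner_le_theta_const\<close>). Halving the index set \<open>log\<^sub>2 n\<close> times therefore gives
  \<open>\<parallel>\<Sum>\<^sub>j y\<^sub>j\<parallel>\<^sup>2 \<le> C \<Sum>\<^sub>j \<parallel>y\<^sub>j\<parallel>\<^sup>2\<close> with \<open>C = (1 + \<theta>) n powr \<sigma>\<close> (\<open>norm_sum_le_window_const\<close>).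

  The converse estimate comes from duality. The adjoints \<open>G\<^sub>m\<^sup>*\<close> also have norm at most \<open>K\<close>, so
  the ranges \<open>T Y\<^sub>j\<close> of the \<open>D\<^sub>j\<^sup>*\<close> satisfy the same upper bound. From
  \<open>\<Sum>\<^sub>j \<parallel>y\<^sub>j\<parallel>\<^sup>2 = w \<bullet> \<Sum>\<^sub>j D\<^sub>j\<^sup>* y\<^sub>j\<close> and \<open>\<parallel>D\<^sub>j\<^sup>*\<parallel> \<le> 2K\<close> one gets
  \<open>\<Sum>\<^sub>j \<parallel>y\<^sub>j\<parallel>\<^sup>2 \<le> (2K)\<^sup>2 C \<parallel>w\<parallel>\<^sup>2\<close> (\<open>sum_norm_details_le\<close>). The two estimates together give
  \<open>\<parallel>J w\<parallel>\<^sup>2 \<le> C \<Sum>\<^sub>j \<parallel>R\<^sub>j y\<^sub>j\<parallel>\<^sup>2 \<le> (2KC)\<^sup>2 \<parallel>w\<parallel>\<^sup>2\<close>.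

  For the second bound, the \<open>Y\<^sub>j\<close> are orthogonal for the form \<open>T x \<bullet> y\<close>, hence
  \<open>T w \<bullet> J w = \<Sum>\<^sub>j \<bar>B\<^sub>j\<bar> y\<^sub>j \<bullet> y\<^sub>j \<ge> \<mu> \<Sum>\<^sub>j \<parallel>y\<^sub>j\<parallel>\<^sup>2\<close>, while the left-hand side is at most
  \<open>\<parallel>T\<parallel> \<parallel>J\<parallel> \<parallel>w\<parallel>\<^sup>2\<close>. That \<open>\<mu>\<close> is positive follows from \<open>\<mu> \<ge> \<beta> / (2K)\<close>
  (\<open>compression_detail_ge_beta\<close>), where \<open>\<beta>\<close> is \<open>\<beta>\<^sub>d\<close>.

  The properties of \<open>R\<^sub>j\<close> rest on the spectral theorem for symmetric operators on
  finite-dimensional subspaces of an inner product space (\<open>spectral_decomposition\<close>).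
\<close>

section \<open>Orthogonal projection onto finite-dimensional subspaces\<close>

lemma fin_dim_subspace_subspace: "fin_dim_subspace S \<Longrightarrow> subspace S"
  by (auto simp: fin_dim_subspace_def)

lemma fin_dim_subspace_mono:
  fixes S W :: "'a::real_inner set"
  assumes "fin_dim_subspace S" "subspace W" "W \<subseteq> S"
  shows "fin_dim_subspace W"
proof -
  obtain A where A: "finite A" "S = span A"
    using assms(1) by (auto simp: fin_dim_subspace_def)
  obtain B where B: "B \<subseteq> W" "independent B" "W \<subseteq> span B"
    by (rule maximal_independent_subset)
  have "finite B"
    using independent_span_bound[OF A(1) B(2)] B(1) assms(3) A(2) by auto
  moreover have "W = span B"
    using B span_minimal[OF B(1) assms(2)] by auto
  ultimately show ?thesis
    by (auto simp: fin_dim_subspace_def)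
qed

lemma fin_dim_subspace_linear_image:
  fixes f :: "'a::real_inner \<Rightarrow> 'a"
  assumes "fin_dim_subspace S" "linear f"
  shows "fin_dim_subspace (f ` S)"
proof -
  obtain A where "finite A" "S = span A"
    using assms(1) by (auto simp: fin_dim_subspace_def)
  then have "finite (f ` A)" "f ` S = span (f ` A)"
    using linear_span_image[OF assms(2)] by auto
  then show ?thesis
    unfolding fin_dim_subspace_def by blast
qed

text \<open>One Gram-Schmidt step: a new direction \<open>b\<close> contributes the component along
  \<open>b\<close> minus its projection.\<close>
lemma orthogonal_decomposition_fin_dim:
  fixes S :: "'a::real_inner set"
  assumes "fin_dim_subspace S"
  shows "\<exists>p\<in>S. \<forall>y\<in>S. (x - p) \<bullet> y = 0"
proof -
  obtain A where A: "finite A" "S = span A"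
    using assms by (auto simp: fin_dim_subspace_def)
  have "\<exists>p\<in>span A. \<forall>y\<in>span A. (x - p) \<bullet> y = 0" for x
    using A(1)
  proof (induction A arbitrary: x rule: finite_induct)
    case empty
    then show ?case by simp
  next
    case (insert b A)
    obtain p where p: "p \<in> span A" "\<forall>y\<in>span A. (x - p) \<bullet> y = 0"
      using insert.IH by blast
    obtain q where q: "q \<in> span A" "\<forall>y\<in>span A. (b - q) \<bullet> y = 0"
      using insert.IH by blast
    define e where "e = b - q"
    define P where "P = p + ((x - p) \<bullet> e / (e \<bullet> e)) *\<^sub>R e"
    have sub: "span A \<subseteq> span (insert b A)"
      by (rule span_mono) auto
    have e: "e \<in> span (insert b A)"
      unfolding e_def using sub q(1) by (intro span_diff) (auto intro: span_base)
    have "P \<in> span (insert b A)"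
      unfolding P_def using sub p(1) e by (intro span_add span_scale) auto
    moreover have "(x - P) \<bullet> y = 0" if "y \<in> span (insert b A)" for y
    proof -
      from that obtain k where k: "y - k *\<^sub>R b \<in> span A"
        using span_breakdown_eq by blast
      define s where "s = y - k *\<^sub>R e"
      have "s = (y - k *\<^sub>R b) + k *\<^sub>R q"
        by (simp add: s_def e_def algebra_simps)
      then have s: "s \<in> span A"
        using k q(1) by (metis span_add span_scale)
      have y: "y = s + k *\<^sub>R e"
        by (simp add: s_def)
      have es: "e \<bullet> s = 0"
        using q(2) s by (auto simp: e_def)
      have xs: "(x - p) \<bullet> s = 0"
        using p(2) s by auto
      have "(x - P) \<bullet> s = 0"
        using es xs by (simp add: P_def inner_simps)
      moreover have "(x - P) \<bullet> e = 0"
        by (cases "e = 0") (auto simp: P_def inner_simps)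
      ultimately show ?thesis
        by (simp add: y inner_simps)
    qed
    ultimately show ?case by blast
  qed
  with A show ?thesis by blast
qed

lemma orth_proj_eqI:
  fixes S :: "'a::real_inner set"
  assumes "subspace S" "p \<in> S" "\<And>y. y \<in> S \<Longrightarrow> x \<bullet> y = p \<bullet> y"
  shows "orth_proj S x = p"
  unfolding orth_proj_def
proof (rule the_equality)
  show "p \<in> S \<and> (\<forall>y\<in>S. (x - p) \<bullet> y = 0)"
    using assms by (auto simp: inner_simps)
  fix q assume q: "q \<in> S \<and> (\<forall>y\<in>S. (x - q) \<bullet> y = 0)"
  have "q - p \<in> S"
    using q assms by (auto intro: subspace_diff)
  then have "(x - q) \<bullet> (q - p) = 0" "x \<bullet> (q - p) = p \<bullet> (q - p)"
    using q assms(3) by blast+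
  then have "(q - p) \<bullet> (q - p) = 0"
    by (simp add: inner_diff_left)
  then show "q = p" by simp
qed

lemma
  fixes S :: "'a::real_inner set"
  assumes "fin_dim_subspace S"
  shows orth_proj_in: "orth_proj S x \<in> S"
    and inner_orth_proj: "y \<in> S \<Longrightarrow> orth_proj S x \<bullet> y = x \<bullet> y"
proof -
  obtain p where p: "p \<in> S" "\<forall>y\<in>S. (x - p) \<bullet> y = 0"
    using orthogonal_decomposition_fin_dim[OF assms] by blast
  have xp: "x \<bullet> y = p \<bullet> y" if "y \<in> S" for y
    using p(2) that by (auto simp: inner_simps)
  have eq: "orth_proj S x = p"
    using fin_dim_subspace_subspace[OF assms] p(1) xp by (rule orth_proj_eqI)
  show "orth_proj S x \<in> S" "y \<in> S \<Longrightarrow> orth_proj S x \<bullet> y = x \<bullet> y"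
    using eq p(1) xp by auto
qed

lemma norm_orth_proj_le:
  fixes S :: "'a::real_inner set"
  assumes "fin_dim_subspace S"
  shows "norm (orth_proj S x) \<le> norm x"
proof -
  have "norm (orth_proj S x) ^ 2 = x \<bullet> orth_proj S x"
    using inner_orth_proj[OF assms orth_proj_in[OF assms]] by (simp add: power2_norm_eq_inner)
  also have "\<dots> \<le> norm x * norm (orth_proj S x)"
    by (rule norm_cauchy_schwarz)
  finally show ?thesis
    by (cases "norm (orth_proj S x) = 0") (auto simp: power2_eq_square)
qed

lemma linear_orth_proj:
  fixes S :: "'a::real_inner set"
  assumes "fin_dim_subspace S"
  shows "linear (orth_proj S)"
proof (rule linearI)
  note S = fin_dim_subspace_subspace[OF assms]
  note pr = orth_proj_in[OF assms] inner_orth_proj[OF assms]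
  show "orth_proj S (x + y) = orth_proj S x + orth_proj S y" for x y
    by (rule orth_proj_eqI[OF S]) (auto simp: pr inner_simps intro: subspace_add[OF S])
  show "orth_proj S (c *\<^sub>R x) = c *\<^sub>R orth_proj S x" for c x
    by (rule orth_proj_eqI[OF S]) (auto simp: pr inner_simps intro: subspace_scale[OF S])
qed

text \<open>Splitting off one orthogonal direction \<open>e\<close> writes the ball as a continuous image of a
  closed part of \<open>[-r/|e|, r/|e|]\<close> times a lower-dimensional ball.\<close>
lemma compact_cball_fin_dim:
  fixes S :: "'a::real_inner set"
  assumes "fin_dim_subspace S"
  shows "compact {x\<in>S. norm x \<le> r}"
proof -
  obtain A where A: "finite A" "S = span A"
    using assms by (auto simp: fin_dim_subspace_def)
  have "compact {x\<in>span A. norm x \<le> r}"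
    using A(1)
  proof (induction A rule: finite_induct)
    case empty
    have "{x\<in>span {}. norm x \<le> r} \<subseteq> {0::'a}"
      by auto
    then show ?case
      using finite_imp_compact finite_subset by blast
  next
    case (insert b A)
    have fd: "fin_dim_subspace (span A)"
      using insert.hyps by (auto simp: fin_dim_subspace_def)
    show ?case
    proof (cases "b \<in> span A")
      case True
      then show ?thesis
        using insert.IH span_redundant by metis
    next
      case False
      define q where "q = orth_proj (span A) b"
      define e where "e = b - q"
      have q: "q \<in> span A" "\<And>y. y \<in> span A \<Longrightarrow> e \<bullet> y = 0"
        using orth_proj_in[OF fd] inner_orth_proj[OF fd]
        by (auto simp: e_def q_def inner_simps)
      have e0: "e \<noteq> 0"
        using False q(1) by (auto simp: e_def)
      define C where "C = ({- (r / norm e)..r / norm e} \<times> {x\<in>span A. norm x \<le> r})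
        \<inter> {z. norm (fst z *\<^sub>R e + snd z) \<le> r}"
      have "compact C"
        unfolding C_def
        by (intro compact_Int_closed compact_Times insert.IH closed_Collect_le continuous_intros) auto
      moreover have "continuous_on C (\<lambda>z. fst z *\<^sub>R e + snd z)"
        by (intro continuous_intros)
      ultimately have "compact ((\<lambda>z. fst z *\<^sub>R e + snd z) ` C)"
        by (rule compact_continuous_image[rotated])
      moreover have "(\<lambda>z. fst z *\<^sub>R e + snd z) ` C = {x\<in>span (insert b A). norm x \<le> r}"
      proof (intro equalityI subsetI)
        fix x assume "x \<in> (\<lambda>z. fst z *\<^sub>R e + snd z) ` C"
        then obtain t s where ts: "s \<in> span A" "x = t *\<^sub>R e + s" "norm x \<le> r"
          unfolding C_def by force
        have "x - t *\<^sub>R b \<in> span A"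
          using span_diff[OF ts(1) span_scale[OF q(1), of t]]
          by (simp add: ts(2) e_def algebra_simps)
        then have "x \<in> span (insert b A)"
          using span_breakdown_eq by blast
        then show "x \<in> {x\<in>span (insert b A). norm x \<le> r}"
          using ts by auto
      next
        fix x assume x: "x \<in> {x\<in>span (insert b A). norm x \<le> r}"
        then obtain t where t: "x - t *\<^sub>R b \<in> span A"
          using span_breakdown_eq by blast
        define s where "s = x - t *\<^sub>R e"
        have "s = (x - t *\<^sub>R b) + t *\<^sub>R q"
          by (simp add: s_def e_def algebra_simps)
        then have s: "s \<in> span A"
          using t q(1) by (metis span_add span_scale)
        have xeq: "x = t *\<^sub>R e + s"
          by (simp add: s_def)
        have "orthogonal (t *\<^sub>R e) s"
          using q(2)[OF s] by (simp add: orthogonal_def)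
        then have pyth: "norm x ^ 2 = norm (t *\<^sub>R e) ^ 2 + norm s ^ 2"
          unfolding xeq by (rule norm_add_Pythagorean)
        have "norm (t *\<^sub>R e) \<le> norm x" "norm s \<le> norm x"
          by (rule power2_le_imp_le, use pyth in simp, simp)+
        then have "\<bar>t\<bar> * norm e \<le> r" "norm s \<le> r"
          using x by auto
        then have "\<bar>t\<bar> \<le> r / norm e" "norm s \<le> r"
          using e0 by (auto simp: field_simps)
        then have "(t, s) \<in> C"
          using s x xeq by (auto simp: C_def)
        then show "x \<in> (\<lambda>z. fst z *\<^sub>R e + snd z) ` C"
          by (rule rev_image_eqI) (simp add: xeq)
      qed
      ultimately show ?thesis by simp
    qed
  qed
  with A show ?thesis by simp
qed

lemma compact_sphere_fin_dim:
  fixes S :: "'a::real_inner set"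
  assumes "fin_dim_subspace S"
  shows "compact {x\<in>S. norm x = 1}"
proof -
  have "compact ({x\<in>S. norm x \<le> 1} \<inter> {x. norm x = 1})"
    by (intro compact_Int_closed compact_cball_fin_dim assms closed_Collect_eq continuous_intros)
  moreover have "{x\<in>S. norm x \<le> 1} \<inter> {x. norm x = 1} = {x\<in>S. norm x = 1}"
    by auto
  ultimately show ?thesis by simp
qed

lemma unit_vector_in_subspace:
  fixes S :: "'a::real_normed_vector set"
  assumes "subspace S" "S \<noteq> {0}"
  obtains x where "x \<in> S" "norm x = 1"
proof -
  obtain y where y: "y \<in> S" "y \<noteq> 0"
    using assms subspace_0[OF assms(1)] by auto
  have "(1 / norm y) *\<^sub>R y \<in> S"
    using assms y by (auto intro: subspace_scale)
  moreover have "norm ((1 / norm y) *\<^sub>R y) = 1"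
    using y by simp
  ultimately show ?thesis using that by blast
qed

section \<open>Spectral theorem on finite-dimensional subspaces\<close>

text \<open>A maximiser \<open>x\<close> of the Rayleigh quotient is an eigenvector: with \<open>c\<close> the maximum, the
  form \<open>c y \<bullet> y - B y \<bullet> y\<close> is positive semidefinite and vanishes at \<open>x\<close>, so \<open>x\<close> lies in its
  radical.\<close>
lemma rayleigh_eigenvector:
  fixes B :: "'a::real_inner \<Rightarrow> 'a"
  assumes M: "fin_dim_subspace M" "M \<noteq> {0}"
    and B: "bounded_linear B" "\<And>x. x \<in> M \<Longrightarrow> B x \<in> M"
    and sym: "\<And>x y. x \<in> M \<Longrightarrow> y \<in> M \<Longrightarrow> B x \<bullet> y = x \<bullet> B y"
  obtains c x where "x \<in> M" "x \<noteq> 0" "B x = c *\<^sub>R x"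
proof -
  note sM = fin_dim_subspace_subspace[OF M(1)]
  interpret B: bounded_linear B by fact
  have "{x\<in>M. norm x = 1} \<noteq> {}"
    using unit_vector_in_subspace[OF sM M(2)] by blast
  moreover have "continuous_on {x\<in>M. norm x = 1} (\<lambda>x. B x \<bullet> x)"
    by (intro continuous_intros B.continuous_on)
  ultimately obtain x where x: "x \<in> M" "norm x = 1"
    and max: "\<And>y. y \<in> M \<Longrightarrow> norm y = 1 \<Longrightarrow> B y \<bullet> y \<le> B x \<bullet> x"
    using continuous_attains_sup[OF compact_sphere_fin_dim[OF M(1)]] by blast
  define c where "c = B x \<bullet> x"
  have pos: "B y \<bullet> y \<le> c * (y \<bullet> y)" if y: "y \<in> M" for y
  proof (cases "y = 0")
    case False
    let ?u = "(1 / norm y) *\<^sub>R y"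
    have "B ?u \<bullet> ?u \<le> c"
      unfolding c_def using False y by (intro max) (auto intro: subspace_scale[OF sM])
    then show ?thesis
      using False by (simp add: B.scaleR field_simps power2_norm_eq_inner[symmetric] power2_eq_square)
  qed (simp add: B.zero)
  define r where "r = B x - c *\<^sub>R x"
  have r: "r \<in> M"
    unfolding r_def using x B(2) by (auto intro: subspace_diff[OF sM] subspace_scale[OF sM])
  have xx: "x \<bullet> x = 1"
    using x(2) by (simp add: norm_eq_1)
  have "2 * t * (r \<bullet> r) \<le> t\<^sup>2 * (c * (r \<bullet> r) - B r \<bullet> r)" for t
  proof -
    have "x + t *\<^sub>R r \<in> M"
      using x r by (auto intro: subspace_add[OF sM] subspace_scale[OF sM])
    note pos[OF this]
    moreover have "B (x + t *\<^sub>R r) \<bullet> (x + t *\<^sub>R r) = c + 2 * t * (B x \<bullet> r) + t\<^sup>2 * (B r \<bullet> r)"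
      using sym[OF x(1) r]
      by (simp add: B.add B.scaleR inner_simps c_def power2_eq_square algebra_simps inner_commute)
    moreover have "(x + t *\<^sub>R r) \<bullet> (x + t *\<^sub>R r) = 1 + 2 * t * (x \<bullet> r) + t\<^sup>2 * (r \<bullet> r)"
      using xx by (simp add: inner_simps power2_eq_square algebra_simps inner_commute)
    moreover have "B x \<bullet> r = c * (x \<bullet> r) + r \<bullet> r"
      by (simp add: r_def inner_simps algebra_simps)
    ultimately show ?thesis
      by (simp only:) (simp add: distrib_left right_diff_distrib mult.assoc mult.left_commute)
  qed
  note quad = this
  have "r \<bullet> r = 0"
  proof (rule ccontr)
    assume "r \<bullet> r \<noteq> 0"
    then have rr: "r \<bullet> r > 0"
      by simp
    \<comment> \<open>\<open>t\<close> is small enough for the linear term of \<open>quad\<close> to dominate the quadratic one.\<close>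
    define d where "d = \<bar>c * (r \<bullet> r) - B r \<bullet> r\<bar> + 1"
    define t where "t = (r \<bullet> r) / d"
    have d: "d > 0" "c * (r \<bullet> r) - B r \<bullet> r \<le> d"
      by (auto simp: d_def)
    then have t: "t > 0"
      using rr by (simp add: t_def)
    have "t\<^sup>2 * (c * (r \<bullet> r) - B r \<bullet> r) \<le> t\<^sup>2 * d"
      using d by (intro mult_left_mono) auto
    also have "\<dots> = t * (r \<bullet> r)"
      using d by (simp add: t_def power2_eq_square)
    finally have "2 * t * (r \<bullet> r) \<le> t * (r \<bullet> r)"
      using quad[of t] by linarith
    then show False
      using t rr by simp
  qed
  then have "B x = c *\<^sub>R x"
    by (simp add: r_def)
  with x show ?thesis
    using that[of x c] by force
qed

locale symmetric_operator =
  fixes S :: "'a::real_inner set" and B :: "'a \<Rightarrow> 'a"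
  assumes fin_dim: "fin_dim_subspace S"
    and bounded: "bounded_linear B"
    and maps_to: "\<And>x. x \<in> S \<Longrightarrow> B x \<in> S"
    and symmetric: "\<And>x y. x \<in> S \<Longrightarrow> y \<in> S \<Longrightarrow> B x \<bullet> y = x \<bullet> B y"
begin

abbreviation spectrum :: "real set" where
  "spectrum \<equiv> {c. eigenspace_on S B c \<noteq> {0}}"

abbreviation spectral_part :: "real \<Rightarrow> 'a \<Rightarrow> 'a" where
  "spectral_part c \<equiv> orth_proj (eigenspace_on S B c)"

interpretation B: bounded_linear B
  by (rule bounded)

lemma subspace_S: "subspace S"
  by (rule fin_dim_subspace_subspace[OF fin_dim])

lemma fin_dim_eigenspace: "fin_dim_subspace (eigenspace_on S B c)"
proof (rule fin_dim_subspace_mono[OF fin_dim])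
  show "subspace (eigenspace_on S B c)"
    unfolding subspace_def eigenspace_on_def
    using subspace_S by (auto simp: B.zero B.add B.scaleR subspace_def algebra_simps)
qed (auto simp: eigenspace_on_def)

lemma eigenspaces_orthogonal:
  assumes "u \<in> eigenspace_on S B c" "v \<in> eigenspace_on S B d" "c \<noteq> d"
  shows "u \<bullet> v = 0"
proof -
  have "c * (u \<bullet> v) = d * (u \<bullet> v)"
    using symmetric[of u v] assms by (auto simp: eigenspace_on_def)
  with assms(3) show ?thesis by simp
qed

lemma spectral_part_eigenspace: "spectral_part c x \<in> eigenspace_on S B c"
  by (rule orth_proj_in[OF fin_dim_eigenspace])

lemma eigenvector_exists:
  assumes "c \<in> spectrum"
  shows "\<exists>v\<in>eigenspace_on S B c. v \<noteq> 0"
  using assms subspace_0[OF fin_dim_subspace_subspace[OF fin_dim_eigenspace]] by blast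

text \<open>Eigenvectors to distinct eigenvalues are orthogonal, hence linearly independent.\<close>
lemma finite_spectrum: "finite spectrum"
proof -
  obtain v where v: "\<And>c. c \<in> spectrum \<Longrightarrow> v c \<in> eigenspace_on S B c \<and> v c \<noteq> 0"
    using eigenvector_exists by metis
  obtain A where A: "finite A" "S = span A"
    using fin_dim by (auto simp: fin_dim_subspace_def)
  have orth: "v c \<bullet> v d = 0" if "c \<in> spectrum" "d \<in> spectrum" "c \<noteq> d" for c d
    using eigenspaces_orthogonal v that by blast
  have "inj_on v spectrum"
    using orth v by (metis (no_types, lifting) inj_onI inner_eq_zero_iff)
  moreover have "independent (v ` spectrum)"
  proof (rule pairwise_orthogonal_independent)
    show "pairwise orthogonal (v ` spectrum)"
      using orth by (fastforce simp: pairwise_def orthogonal_def)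
    show "0 \<notin> v ` spectrum"
      using v by (metis (no_types, lifting) imageE)
  qed
  moreover have "v ` spectrum \<subseteq> span A"
    using v A(2) by (auto simp: eigenspace_on_def)
  ultimately show ?thesis
    using independent_span_bound[OF A(1)] finite_image_iff by blast
qed

text \<open>The vectors of \<open>S\<close> orthogonal to all eigenspaces form an invariant subspace; if it were
  nonzero, the Rayleigh quotient would provide an eigenvector in it.\<close>
lemma spectral_decomposition:
  assumes "x \<in> S"
  shows "(\<Sum>c\<in>spectrum. spectral_part c x) = x"
proof -
  define M where "M = {x\<in>S. \<forall>c. \<forall>v\<in>eigenspace_on S B c. x \<bullet> v = 0}"
  have "subspace M"
    using subspace_S by (auto simp: M_def subspace_def inner_simps)
  then have M: "fin_dim_subspace M"
    by (rule fin_dim_subspace_mono[OF fin_dim]) (auto simp: M_def)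
  have BM: "B y \<in> M" if "y \<in> M" for y
  proof -
    have "B y \<bullet> v = 0" if "v \<in> eigenspace_on S B c" for v c
      using symmetric[of y v] that \<open>y \<in> M\<close> by (auto simp: M_def eigenspace_on_def)
    then show ?thesis
      using maps_to that by (auto simp: M_def)
  qed
  have M0: "M = {0}"
  proof (rule ccontr)
    assume ne: "M \<noteq> {0}"
    have sym: "B x \<bullet> y = x \<bullet> B y" if "x \<in> M" "y \<in> M" for x y
      using symmetric that by (auto simp: M_def)
    obtain c v where "v \<in> M" "v \<noteq> 0" "B v = c *\<^sub>R v"
      by (rule rayleigh_eigenvector[OF M ne bounded]) (use BM sym in auto)
    then have "v \<in> eigenspace_on S B c" "\<forall>u\<in>eigenspace_on S B c. v \<bullet> u = 0"
      by (auto simp: M_def eigenspace_on_def)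
    with \<open>v \<noteq> 0\<close> show False
      by auto
  qed
  define r where "r = x - (\<Sum>c\<in>spectrum. spectral_part c x)"
  have "r \<in> S"
    unfolding r_def using assms spectral_part_eigenspace
    by (intro subspace_diff subspace_sum subspace_S) (auto simp: eigenspace_on_def)
  moreover have "r \<bullet> v = 0" if v: "v \<in> eigenspace_on S B d" for v d
  proof (cases "v = 0")
    case False
    then have d: "d \<in> spectrum"
      using v by auto
    have "(\<Sum>c\<in>spectrum. spectral_part c x \<bullet> v) = (\<Sum>c\<in>spectrum. if c = d then x \<bullet> v else 0)"
      using eigenspaces_orthogonal[OF spectral_part_eigenspace v] inner_orth_proj[OF fin_dim_eigenspace v]
      by (intro sum.cong) auto
    also have "\<dots> = x \<bullet> v"
      using d finite_spectrum by (simp add: sum.delta)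
    finally show ?thesis
      by (simp add: r_def inner_simps inner_sum_left)
  qed simp
  ultimately have "r \<in> M"
    by (auto simp: M_def)
  with M0 show ?thesis
    by (simp add: r_def)
qed

lemma inner_spectral_sums:
  "(\<Sum>c\<in>spectrum. f c *\<^sub>R spectral_part c x) \<bullet> (\<Sum>c\<in>spectrum. g c *\<^sub>R spectral_part c x)
    = (\<Sum>c\<in>spectrum. f c * g c * (norm (spectral_part c x))\<^sup>2)"
proof -
  have "(f c *\<^sub>R spectral_part c x) \<bullet> (\<Sum>d\<in>spectrum. g d *\<^sub>R spectral_part d x)
     = f c * g c * (norm (spectral_part c x))\<^sup>2" if c: "c \<in> spectrum" for c
  proof -
    have "(f c *\<^sub>R spectral_part c x) \<bullet> (\<Sum>d\<in>spectrum. g d *\<^sub>R spectral_part d x)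
      = (\<Sum>d\<in>spectrum. if d = c then f c * g c * (norm (spectral_part c x))\<^sup>2 else 0)"
      unfolding inner_sum_right
      using eigenspaces_orthogonal[OF spectral_part_eigenspace spectral_part_eigenspace]
      by (intro sum.cong) (auto simp: power2_norm_eq_inner)
    then show ?thesis
      using c finite_spectrum by (simp add: sum.delta)
  qed
  then show ?thesis
    unfolding inner_sum_left by (intro sum.cong refl)
qed

lemma norm_spectral_parts:
  assumes "x \<in> S"
  shows "(\<Sum>c\<in>spectrum. (norm (spectral_part c x))\<^sup>2) = (norm x)\<^sup>2"
  using inner_spectral_sums[of "\<lambda>_. 1" x "\<lambda>_. 1"] spectral_decomposition[OF assms]
  by (simp add: power2_norm_eq_inner)

lemma apply_spectral_decomposition:
  assumes "x \<in> S"
  shows "B x = (\<Sum>c\<in>spectrum. c *\<^sub>R spectral_part c x)"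
proof -
  have "B x = B (\<Sum>c\<in>spectrum. spectral_part c x)"
    using spectral_decomposition[OF assms] by simp
  also have "\<dots> = (\<Sum>c\<in>spectrum. B (spectral_part c x))"
    by (rule B.sum)
  also have "\<dots> = (\<Sum>c\<in>spectrum. c *\<^sub>R spectral_part c x)"
    using spectral_part_eigenspace by (intro sum.cong) (auto simp: eigenspace_on_def)
  finally show ?thesis .
qed

lemma spectral_apply_in: "spectral_apply f S B x \<in> S"
  unfolding spectral_apply_def
  using spectral_part_eigenspace
  by (intro subspace_sum subspace_scale subspace_S) (auto simp: eigenspace_on_def)

context
  fixes m :: real
  assumes m: "m > 0" and below: "\<And>x. x \<in> S \<Longrightarrow> m * norm x \<le> norm (B x)"
begin

lemma spectrum_bounded_below:
  assumes "c \<in> spectrum"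
  shows "m \<le> \<bar>c\<bar>"
proof -
  obtain v where v: "v \<in> eigenspace_on S B c" "v \<noteq> 0"
    using eigenvector_exists[OF assms] by blast
  then have "m * norm v \<le> \<bar>c\<bar> * norm v"
    using below[of v] by (auto simp: eigenspace_on_def)
  then show ?thesis
    using v by simp
qed

lemma norm_sign_le:
  assumes "x \<in> S"
  shows "norm (spectral_apply sgn S B x) \<le> norm x"
proof -
  have "(norm (spectral_apply sgn S B x))\<^sup>2
      = (\<Sum>c\<in>spectrum. sgn c * sgn c * (norm (spectral_part c x))\<^sup>2)"
    using inner_spectral_sums[of sgn x sgn] by (simp add: spectral_apply_def power2_norm_eq_inner)
  also have "\<dots> \<le> (\<Sum>c\<in>spectrum. (norm (spectral_part c x))\<^sup>2)"
    by (intro sum_mono) (auto simp: sgn_if)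
  finally show ?thesis
    using norm_spectral_parts[OF assms] by (auto intro: power2_le_imp_le)
qed

text \<open>This is \<open>\<bar>B\<bar> \<ge> m\<close>, as \<open>B sgn(B) = \<bar>B\<bar>\<close>.\<close>
lemma inner_sign_ge:
  assumes "x \<in> S"
  shows "m * (norm x)\<^sup>2 \<le> B x \<bullet> spectral_apply sgn S B x"
proof -
  have "m * (norm x)\<^sup>2 = (\<Sum>c\<in>spectrum. m * (norm (spectral_part c x))\<^sup>2)"
    using norm_spectral_parts[OF assms] by (simp add: sum_distrib_left[symmetric])
  also have "\<dots> \<le> (\<Sum>c\<in>spectrum. c * sgn c * (norm (spectral_part c x))\<^sup>2)"
    using spectrum_bounded_below by (intro sum_mono mult_right_mono) (auto simp: abs_sgn[symmetric])
  also have "\<dots> = B x \<bullet> spectral_apply sgn S B x"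
    unfolding apply_spectral_decomposition[OF assms] spectral_apply_def
    by (rule inner_spectral_sums[symmetric])
  finally show ?thesis .
qed

lemma bij_betw_if_bounded_below: "bij_betw B S S"
proof -
  have "inj_on B S"
  proof (rule inj_onI)
    fix x y assume xy: "x \<in> S" "y \<in> S" "B x = B y"
    then have "m * norm (x - y) \<le> 0"
      using below[of "x - y"] subspace_diff[OF subspace_S, of x y] by (simp add: B.diff)
    then show "x = y"
      using m by (simp add: mult_le_0_iff)
  qed
  moreover have "y \<in> B ` S" if y: "y \<in> S" for y
  proof -
    define x where "x = (\<Sum>c\<in>spectrum. (1 / c) *\<^sub>R spectral_part c y)"
    have "x \<in> S"
      unfolding x_def using spectral_part_eigenspace
      by (intro subspace_sum subspace_scale subspace_S) (auto simp: eigenspace_on_def)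
    moreover have "B x = (\<Sum>c\<in>spectrum. (1 / c) *\<^sub>R B (spectral_part c y))"
      by (simp add: x_def B.sum B.scaleR)
    then have "B x = (\<Sum>c\<in>spectrum. spectral_part c y)"
    proof (rule trans, intro sum.cong refl)
      fix c assume c: "c \<in> spectrum"
      have "c \<noteq> 0"
        using spectrum_bounded_below[OF c] m by auto
      then show "(1 / c) *\<^sub>R B (spectral_part c y) = spectral_part c y"
        using spectral_part_eigenspace[of c y] by (auto simp: eigenspace_on_def)
    qed
    then have "B x = y"
      using spectral_decomposition[OF y] by simp
    ultimately show ?thesis by blast
  qed
  ultimately show ?thesis
    using maps_to by (auto simp: bij_betw_def)
qed

end

end

section \<open>Inf-sup constants of compressions\<close>

lemma inner_compression:
  assumes "fin_dim_subspace S" "y \<in> S"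
  shows "compression T S x \<bullet> y = T x \<bullet> y"
  using inner_orth_proj[OF assms] by (simp add: compression_def)

lemma symmetric_operator_compression:
  fixes T :: "'a::real_inner \<Rightarrow> 'a"
  assumes S: "fin_dim_subspace S" and T: "bounded_linear T" "self_adjoint T"
  shows "symmetric_operator S (compression T S)"
proof (rule symmetric_operator.intro)
  interpret T: bounded_linear T by fact
  interpret P: linear "orth_proj S" by (rule linear_orth_proj[OF S])
  show "fin_dim_subspace S" by fact
  show "bounded_linear (compression T S)"
  proof (rule bounded_linear_intro[where K = "onorm T"])
    show "norm (compression T S x) \<le> norm x * onorm T" for x
      using norm_orth_proj_le[OF S, of "T x"] onorm[OF T(1), of x]
      by (simp add: compression_def mult.commute)
  qed (simp_all add: compression_def T.add T.scaleR P.add P.scale)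
  show "compression T S x \<in> S" for x
    using orth_proj_in[OF S] by (simp add: compression_def)
  show "compression T S x \<bullet> y = x \<bullet> compression T S y" if "x \<in> S" "y \<in> S" for x y
    using that T(2) inner_compression[OF S, of x T y] inner_compression[OF S, of y T x]
    by (simp add: self_adjoint_def inner_commute)
qed

context symmetric_operator
begin

interpretation B: bounded_linear B
  by (rule bounded)

lemma bounded_below_if_bij:
  assumes "bij_betw B S S" "S \<noteq> {0}"
  obtains m where "m > 0" "\<And>x. x \<in> S \<Longrightarrow> m * norm x \<le> norm (B x)"
proof -
  have "{x\<in>S. norm x = 1} \<noteq> {}"
    using unit_vector_in_subspace[OF subspace_S assms(2)] by blast
  moreover have "continuous_on {x\<in>S. norm x = 1} (\<lambda>x. norm (B x))"
    by (intro continuous_intros B.continuous_on)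
  ultimately obtain x where x: "x \<in> S" "norm x = 1"
    and min: "\<And>y. y \<in> S \<Longrightarrow> norm y = 1 \<Longrightarrow> norm (B x) \<le> norm (B y)"
    using continuous_attains_inf[OF compact_sphere_fin_dim[OF fin_dim]] by blast
  have "B x \<noteq> B 0"
    using assms(1) x subspace_0[OF subspace_S] by (metis bij_betw_def inj_on_def norm_zero zero_neq_one)
  then have "norm (B x) > 0"
    by (simp add: B.zero)
  moreover have "norm (B x) * norm y \<le> norm (B y)" if y: "y \<in> S" for y
  proof (cases "y = 0")
    case False
    have "norm (B x) \<le> norm (B ((1 / norm y) *\<^sub>R y))"
      using y False by (intro min subspace_scale[OF subspace_S]) auto
    then show ?thesis
      using False by (simp add: B.scaleR field_simps)
  qed simp
  ultimately show ?thesis by (rule that)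
qed

text \<open>The lower bound on \<open>B\<close> makes the supremum in \<^const>\<open>onorm_on\<close> one over a bounded set, so
  that it is the norm of the inverse.\<close>
lemma
  assumes bij: "bij_betw B S S" and S: "S \<noteq> {0}"
  shows onorm_on_inverse_pos: "onorm_on S (inv_into S B) > 0"
    and inverse_onorm_on_le: "x \<in> S \<Longrightarrow> inverse (onorm_on S (inv_into S B)) * norm x \<le> norm (B x)"
proof -
  obtain m where m: "m > 0" "\<And>x. x \<in> S \<Longrightarrow> m * norm x \<le> norm (B x)"
    using bounded_below_if_bij[OF bij S] by blast
  have inv: "inv_into S B (B x) = x" if "x \<in> S" for x
    using bij that by (simp add: bij_betw_def)
  have "norm (inv_into S B y) / norm y \<le> 1 / m" if "y \<in> S" for y
  proof -
    obtain x where x: "x \<in> S" "y = B x"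
      using bij \<open>y \<in> S\<close> by (auto simp: bij_betw_def)
    then show ?thesis
      using m(1) m(2)[OF x(1)] by (cases "y = 0") (auto simp: inv field_simps)
  qed
  then have bdd: "bdd_above ((\<lambda>y. norm (inv_into S B y) / norm y) ` S)"
    by (auto intro!: bdd_aboveI2)
  have le: "norm x / norm (B x) \<le> onorm_on S (inv_into S B)" if x: "x \<in> S" for x
    using cSUP_upper[OF maps_to[OF x] bdd] inv[OF x] by (simp add: onorm_on_def)
  obtain x where x: "x \<in> S" "norm x = 1"
    using unit_vector_in_subspace[OF subspace_S S] by blast
  have "norm (B x) > 0"
    using m(1) m(2)[OF x(1)] by (metis x(2) mult.right_neutral order_less_le_trans)
  then have "0 < norm x / norm (B x)"
    using x by simp
  with le[OF x(1)] show pos: "onorm_on S (inv_into S B) > 0"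
    by linarith
  show "inverse (onorm_on S (inv_into S B)) * norm x \<le> norm (B x)" if x: "x \<in> S" for x
  proof (cases "x = 0")
    case False
    then have "norm (B x) > 0"
      using m(1) m(2)[OF x] by (smt (verit) mult_pos_pos zero_less_norm_iff)
    then show ?thesis
      using le[OF x] pos by (simp add: field_simps)
  qed simp
qed

lemma inverse_onorm_on_ge:
  assumes m: "m > 0" "\<And>x. x \<in> S \<Longrightarrow> m * norm x \<le> norm (B x)" and S: "S \<noteq> {0}"
  shows "m \<le> inverse (onorm_on S (inv_into S B))"
proof -
  have bij: "bij_betw B S S"
    using bij_betw_if_bounded_below[OF m] .
  have "onorm_on S (inv_into S B) \<le> 1 / m"
    unfolding onorm_on_def
  proof (rule cSUP_least)
    show "S \<noteq> {}"
      using subspace_0[OF subspace_S] by blast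
    fix y assume "y \<in> S"
    then obtain x where x: "x \<in> S" "y = B x"
      using bij by (auto simp: bij_betw_def)
    then have "inv_into S B y = x"
      using bij by (simp add: bij_betw_def)
    then show "norm (inv_into S B y) / norm y \<le> 1 / m"
      using x m(1) m(2)[OF x(1)] by (cases "y = 0") (auto simp: field_simps)
  qed
  then show ?thesis
    using onorm_on_inverse_pos[OF bij S] m(1) by (simp add: field_simps)
qed

end

lemma inf_sup_const_le:
  assumes V: "\<And>j. symmetric_operator (V j) (compression T (V j))"
    and bij: "\<And>j. bij_betw (compression T (V j)) (V j) (V j)"
    and x: "x \<in> V j"
  shows "inf_sup_const T V * norm x \<le> norm (compression T (V j) x)"
proof (cases "V j = {0}")
  case False
  let ?f = "\<lambda>j. inverse (onorm_on (V j) (inv_into (V j) (compression T (V j))))"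
  have "bdd_below (?f ` {j. V j \<noteq> {0}})"
    using symmetric_operator.onorm_on_inverse_pos[OF V bij]
    by (intro bdd_belowI2[of _ 0]) (auto simp: less_imp_le)
  then have "inf_sup_const T V \<le> ?f j"
    unfolding inf_sup_const_def using False by (intro cINF_lower) auto
  then have "inf_sup_const T V * norm x \<le> ?f j * norm x"
    by (intro mult_right_mono) auto
  also have "\<dots> \<le> norm (compression T (V j) x)"
    by (rule symmetric_operator.inverse_onorm_on_le[OF V bij False x])
  finally show ?thesis .
qed (use x in simp)

lemma inf_sup_const_ge:
  assumes V: "\<And>j. symmetric_operator (V j) (compression T (V j))"
    and m: "m > 0" "\<And>j x. x \<in> V j \<Longrightarrow> m * norm x \<le> norm (compression T (V j) x)"
    and nontrivial: "\<exists>j. V j \<noteq> {0}"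
  shows "m \<le> inf_sup_const T V"
  unfolding inf_sup_const_def
  using nontrivial symmetric_operator.inverse_onorm_on_ge[OF V m] by (intro cINF_greatest) auto

section \<open>Almost orthogonality from a basis constant\<close>

text \<open>A projection of norm at most \<open>K\<close> keeps its range and its kernel at an angle with cosine
  at most \<open>\<surd>(1 - K\<^sup>-\<^sup>2)\<close>: the hypothesis for the \<open>t\<close> that minimises \<open>\<parallel>u + t v\<parallel>\<close> bounds
  \<open>u\<close> by \<open>K\<close> times its component orthogonal to \<open>v\<close>.\<close>
lemma inner_le_theta_const:
  fixes u v :: "'a::real_inner"
  assumes K: "K \<ge> 1" and le: "\<And>t. norm u \<le> K * norm (u + t *\<^sub>R v)"
  shows "\<bar>u \<bullet> v\<bar> \<le> theta_const K * (norm u * norm v)"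
proof (cases "v = 0")
  case False
  define t where "t = - (u \<bullet> v) / (v \<bullet> v)"
  have vv: "v \<bullet> v > 0"
    using False by simp
  have "(norm u)\<^sup>2 \<le> (K * norm (u + t *\<^sub>R v))\<^sup>2"
    by (rule power_mono[OF le]) simp
  also have "\<dots> = K\<^sup>2 * (u \<bullet> u + 2 * t * (u \<bullet> v) + t\<^sup>2 * (v \<bullet> v))"
    unfolding power_mult_distrib power2_norm_eq_inner
    by (simp add: inner_simps inner_commute power2_eq_square algebra_simps)
  also have "u \<bullet> u + 2 * t * (u \<bullet> v) + t\<^sup>2 * (v \<bullet> v) = (norm u)\<^sup>2 - (u \<bullet> v)\<^sup>2 / (norm v)\<^sup>2"
    using vv unfolding power2_norm_eq_inner
    by (simp add: t_def power2_eq_square field_simps)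
  finally have "(u \<bullet> v)\<^sup>2 \<le> (1 - 1 / K\<^sup>2) * ((norm u)\<^sup>2 * (norm v)\<^sup>2)"
    using K False by (simp add: field_simps)
  then have "sqrt ((u \<bullet> v)\<^sup>2) \<le> sqrt ((1 - 1 / K\<^sup>2) * ((norm u)\<^sup>2 * (norm v)\<^sup>2))"
    by (rule real_sqrt_le_mono)
  then show ?thesis
    by (simp add: theta_const_def real_sqrt_mult)
qed simp

lemma theta_const_nonneg: "K \<ge> 1 \<Longrightarrow> theta_const K \<ge> 0"
  by (simp add: theta_const_def divide_simps)

lemma split_nat_set_at_card:
  fixes I :: "nat set"
  assumes "finite I" "p \<le> card I" "p > 0"
  obtains m where "card {i\<in>I. i \<le> m} = p"
proof -
  let ?Q = "\<lambda>m. p \<le> card {i\<in>I. i \<le> m}"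
  have "{i\<in>I. i \<le> Max I} = I"
    using assms(1) by auto
  then have "?Q (Max I)"
    using assms(2) by simp
  then have Q: "?Q (LEAST m. ?Q m)"
    by (rule LeastI)
  define m where "m = (LEAST m. ?Q m)"
  have "card {i\<in>I. i < m} < p"
  proof (cases m)
    case (Suc m')
    then have "\<not> ?Q m'"
      unfolding m_def by (metis lessI not_less_Least)
    then show ?thesis
      using Suc by (simp add: less_Suc_eq_le)
  qed (use assms in simp)
  moreover have "card {i\<in>I. i \<le> m} \<le> card (insert m {i\<in>I. i < m})"
    using assms(1) by (intro card_mono) auto
  moreover have "card (insert m {i\<in>I. i < m}) \<le> Suc (card {i\<in>I. i < m})"
    by (rule card_insert_le_m1) simp_all
  ultimately have "card {i\<in>I. i \<le> m} = p"
    using Q by (simp add: m_def)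
  then show ?thesis by (rule that)
qed

text \<open>Halving the index set costs a factor \<open>1 + \<theta>\<close>, since the two halves are vectors \<open>u\<close>, \<open>v\<close>
  with \<open>2 u \<bullet> v \<le> 2 \<theta> \<parallel>u\<parallel> \<parallel>v\<parallel> \<le> \<theta> (\<parallel>u\<parallel>\<^sup>2 + \<parallel>v\<parallel>\<^sup>2)\<close>. The main hypothesis says that the
  sequence \<open>z\<close> has basis constant at most \<open>K\<close>.\<close>
lemma norm_sum_le_dyadic:
  fixes z :: "nat \<Rightarrow> 'a::real_inner"
  assumes K: "K \<ge> 1"
    and basis: "\<And>J m c. finite J \<Longrightarrow>
      norm (\<Sum>j\<in>{j\<in>J. j \<le> m}. c j *\<^sub>R z j) \<le> K * norm (\<Sum>j\<in>J. c j *\<^sub>R z j)"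
    and I: "finite I" "card I \<le> 2 ^ k"
  shows "(norm (\<Sum>j\<in>I. z j))\<^sup>2 \<le> (1 + theta_const K) ^ k * (\<Sum>j\<in>I. (norm (z j))\<^sup>2)"
  using I
proof (induction k arbitrary: I)
  case 0
  then consider "I = {}" | i where "I = {i}"
    by (auto simp: le_Suc_eq card_1_singleton_iff)
  then show ?case
    by cases auto
next
  case (Suc k)
  let ?\<theta> = "theta_const K" and ?S = "\<lambda>J. \<Sum>j\<in>J. (norm (z j))\<^sup>2"
  have \<theta>: "?\<theta> \<ge> 0"
    by (rule theta_const_nonneg[OF K])
  show ?case
  proof (cases "card I \<le> 2 ^ k")
    case True
    have "(norm (\<Sum>j\<in>I. z j))\<^sup>2 \<le> (1 + ?\<theta>) ^ k * ?S I"
      by (rule Suc.IH[OF Suc.prems(1) True])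
    also have "\<dots> \<le> (1 + ?\<theta>) ^ Suc k * ?S I"
      using \<theta> by (intro mult_right_mono power_increasing sum_nonneg) auto
    finally show ?thesis .
  next
    case False
    then obtain m where m: "card {i\<in>I. i \<le> m} = 2 ^ k"
      using split_nat_set_at_card[of I "2 ^ k"] Suc.prems(1) by auto
    define L where "L = {i\<in>I. i \<le> m}"
    define R where "R = {i\<in>I. i > m}"
    have LR: "I = L \<union> R" "L \<inter> R = {}" "finite L" "finite R"
      using Suc.prems(1) by (auto simp: L_def R_def)
    have "card I = card L + card R"
      unfolding LR(1) by (rule card_Un_disjoint[OF LR(3,4,2)])
    then have cards: "card L \<le> 2 ^ k" "card R \<le> 2 ^ k"
      using m[folded L_def] Suc.prems(2) by simp_all
    define u where "u = (\<Sum>j\<in>L. z j)"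
    define v where "v = (\<Sum>j\<in>R. z j)"
    have sum: "(\<Sum>j\<in>I. z j) = u + v" "?S I = ?S L + ?S R"
      unfolding u_def v_def LR(1) by (intro sum.union_disjoint LR)+
    have "norm u \<le> K * norm (u + t *\<^sub>R v)" for t
    proof -
      define c where "c = (\<lambda>j. if j \<le> m then 1 else t)"
      have "(\<Sum>j\<in>L. c j *\<^sub>R z j) = u"
        unfolding u_def by (intro sum.cong) (auto simp: c_def L_def)
      moreover have "(\<Sum>j\<in>R. c j *\<^sub>R z j) = t *\<^sub>R v"
        unfolding v_def scaleR_sum_right by (intro sum.cong) (auto simp: c_def R_def)
      ultimately have "(\<Sum>j\<in>I. c j *\<^sub>R z j) = u + t *\<^sub>R v" "(\<Sum>j\<in>{j\<in>I. j \<le> m}. c j *\<^sub>R z j) = u"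
        using sum.union_disjoint[OF LR(3,4,2), of "\<lambda>j. c j *\<^sub>R z j"]
        by (simp_all only: LR(1)[symmetric] L_def[symmetric])
      then show ?thesis
        using basis[OF Suc.prems(1), where m = m and c = c] by simp
    qed
    then have "\<bar>u \<bullet> v\<bar> \<le> ?\<theta> * (norm u * norm v)"
      by (rule inner_le_theta_const[OF K])
    moreover have "?\<theta> * (2 * (norm u * norm v)) \<le> ?\<theta> * ((norm u)\<^sup>2 + (norm v)\<^sup>2)"
      using sum_squares_bound[of "norm u" "norm v"] \<theta> by (intro mult_left_mono) (auto simp: mult.assoc)
    ultimately have "(norm (u + v))\<^sup>2 \<le> (1 + ?\<theta>) * ((norm u)\<^sup>2 + (norm v)\<^sup>2)"
      by (simp add: power2_norm_eq_inner inner_simps inner_commute algebra_simps abs_le_iff)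
    also have "\<dots> \<le> (1 + ?\<theta>) * ((1 + ?\<theta>) ^ k * ?S L + (1 + ?\<theta>) ^ k * ?S R)"
      unfolding u_def v_def using Suc.IH[OF LR(3) cards(1)] Suc.IH[OF LR(4) cards(2)] \<theta>
      by (intro mult_left_mono add_mono) auto
    finally show ?thesis
      by (simp add: sum algebra_simps)
  qed
qed

text \<open>A bound for \<open>\<parallel>\<Sum>\<^sub>j z\<^sub>j\<parallel>\<^sup>2 / \<Sum>\<^sub>j \<parallel>z\<^sub>j\<parallel>\<^sup>2\<close> over families of \<open>n\<close> vectors with basis constant \<open>K\<close>.\<close>
definition window_const :: "real \<Rightarrow> nat \<Rightarrow> real" where
  "window_const K n = (1 + theta_const K) * real n powr sigma_const K"

lemma window_const_nonneg: "K \<ge> 1 \<Longrightarrow> window_const K n \<ge> 0"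
  using theta_const_nonneg[of K] by (simp add: window_const_def)

text \<open>Rounding \<open>log\<^sub>2 n\<close> up to an integer accounts for the factor \<open>1 + \<theta>\<close> in front of
  \<open>(1 + \<theta>) powr (log\<^sub>2 n) = n powr \<sigma>\<close>.\<close>
lemma norm_sum_le_window_const:
  fixes z :: "nat \<Rightarrow> 'a::real_inner"
  assumes K: "K \<ge> 1"
    and basis: "\<And>J m c. finite J \<Longrightarrow>
      norm (\<Sum>j\<in>{j\<in>J. j \<le> m}. c j *\<^sub>R z j) \<le> K * norm (\<Sum>j\<in>J. c j *\<^sub>R z j)"
    and I: "finite I" "I \<noteq> {}"
  shows "(norm (\<Sum>j\<in>I. z j))\<^sup>2 \<le> window_const K (card I) * (\<Sum>j\<in>I. (norm (z j))\<^sup>2)"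
proof -
  define n where "n = card I"
  have n: "n \<ge> 1"
    using I by (simp add: n_def Suc_leI card_gt_0_iff)
  define k where "k = nat \<lceil>log 2 n\<rceil>"
  have log: "log 2 n \<ge> 0"
    using n by simp
  have k: "log 2 n \<le> k" "k \<le> 1 + log 2 n"
    using log by (auto simp: k_def) linarith
  let ?a = "1 + theta_const K"
  have a: "?a \<ge> 1"
    using theta_const_nonneg[OF K] by simp
  have "real n \<le> 2 powr k"
    using k(1) n by (simp add: log_le_iff)
  then have "real n \<le> real (2 ^ k)"
    by (simp add: powr_realpow)
  then have "n \<le> 2 ^ k"
    by (rule of_nat_le_iff[THEN iffD1])
  then have "(norm (\<Sum>j\<in>I. z j))\<^sup>2 \<le> ?a ^ k * (\<Sum>j\<in>I. (norm (z j))\<^sup>2)"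
    using norm_sum_le_dyadic[OF K basis I(1)] by (simp add: n_def)
  moreover have "?a ^ k \<le> window_const K n"
  proof -
    have "?a ^ k = ?a powr k"
      using a by (simp add: powr_realpow)
    also have "\<dots> \<le> ?a powr (1 + log 2 n)"
      using a k(2) by (intro powr_mono) auto
    also have "\<dots> = ?a * ?a powr log 2 n"
      using a by (simp add: powr_add)
    also have "?a powr log 2 n = n powr sigma_const K"
      using a n by (simp add: sigma_const_def powr_def log_def)
    finally show ?thesis
      by (simp add: window_const_def)
  qed
  ultimately show ?thesis
    unfolding n_def by (smt (verit) mult_right_mono sum_nonneg zero_le_power2)
qed

section \<open>Galerkin projections\<close>

locale galerkin_scale =
  fixes T :: "'a::real_inner \<Rightarrow> 'a" and X :: "nat \<Rightarrow> 'a set"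
  assumes bounded_linear_T: "bounded_linear T"
    and self_adjoint_T: "self_adjoint T"
    and surj_T: "surj T"
    and fin_dim_X: "\<And>l. fin_dim_subspace (X l)"
    and X_Suc: "\<And>l. X l \<subseteq> X (Suc l)"
    and X_nontrivial: "\<exists>l. X l \<noteq> {0}"
    and bij_compression: "\<And>l. bij_betw (compression T (X l)) (X l) (X l)"
    and inf_sup_pos: "inf_sup_const T X > 0"
begin

abbreviation \<beta> :: real where "\<beta> \<equiv> inf_sup_const T X"
abbreviation \<mu> :: real where "\<mu> \<equiv> inf_sup_const T (detail_space T X)"
abbreviation K :: real where "K \<equiv> galerkin_const T X"
abbreviation G :: "nat \<Rightarrow> 'a \<Rightarrow> 'a" where "G l \<equiv> galerkin T (X l)"
abbreviation Y :: "nat \<Rightarrow> 'a set" where "Y \<equiv> detail_space T X"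

definition D :: "nat \<Rightarrow> 'a \<Rightarrow> 'a" where
  "D j x = G j x - (if j = 0 then 0 else G (j - 1) x)"

sublocale T: bounded_linear T
  by (rule bounded_linear_T)

lemma T_sym: "T x \<bullet> y = T y \<bullet> x"
  using self_adjoint_T by (simp add: self_adjoint_def inner_commute)

lemma subspace_X: "subspace (X l)"
  by (rule fin_dim_subspace_subspace[OF fin_dim_X])

lemma X_mono: "j \<le> k \<Longrightarrow> X j \<subseteq> X k"
  by (rule lift_Suc_mono_le[of X, OF X_Suc])

lemma compression_X_ge: "x \<in> X l \<Longrightarrow> \<beta> * norm x \<le> norm (compression T (X l) x)"
  by (rule inf_sup_const_le[OF symmetric_operator_compression bij_compression])
    (auto intro: fin_dim_X bounded_linear_T self_adjoint_T)

lemma galerkin_eqI: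
  assumes g: "g \<in> X l" and eq: "\<And>y. y \<in> X l \<Longrightarrow> T g \<bullet> y = T x \<bullet> y"
  shows "G l x = g"
  unfolding galerkin_def
proof (rule the_equality)
  show "g \<in> X l \<and> (\<forall>y\<in>X l. T g \<bullet> y = T x \<bullet> y)"
    using assms by auto
  fix h assume h: "h \<in> X l \<and> (\<forall>y\<in>X l. T h \<bullet> y = T x \<bullet> y)"
  have hg: "h - g \<in> X l"
    using h g subspace_X by (auto intro: subspace_diff)
  have "compression T (X l) (h - g) = 0"
    unfolding compression_def
    by (rule orth_proj_eqI[OF subspace_X subspace_0[OF subspace_X]])
      (use h eq in \<open>auto simp: T.diff inner_simps\<close>)
  then have "\<beta> * norm (h - g) \<le> 0"
    using compression_X_ge[OF hg] by simp
  then show "h = g"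
    using inf_sup_pos by (simp add: mult_le_0_iff)
qed

lemma
  shows galerkin_in: "G l x \<in> X l"
    and T_galerkin: "y \<in> X l \<Longrightarrow> T (G l x) \<bullet> y = T x \<bullet> y"
proof -
  obtain g where g: "g \<in> X l" "compression T (X l) g = orth_proj (X l) (T x)"
    using bij_compression[of l] orth_proj_in[OF fin_dim_X, of l "T x"]
    by (metis bij_betw_def imageE)
  have Tg: "T g \<bullet> y = T x \<bullet> y" if "y \<in> X l" for y
    using inner_compression[OF fin_dim_X that, of T g] inner_orth_proj[OF fin_dim_X that, of "T x"] g(2)
    by simp
  have "G l x = g"
    by (rule galerkin_eqI[OF g(1) Tg])
  then show "G l x \<in> X l" "y \<in> X l \<Longrightarrow> T (G l x) \<bullet> y = T x \<bullet> y"
    using g(1) Tg by auto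
qed

lemma galerkin_fixed: "x \<in> X l \<Longrightarrow> G l x = x"
  by (rule galerkin_eqI) auto

lemma galerkin_add: "G l (x + y) = G l x + G l y"
  by (rule galerkin_eqI)
    (auto simp: T.add inner_simps T_galerkin intro: subspace_add[OF subspace_X] galerkin_in)

lemma galerkin_scaleR: "G l (c *\<^sub>R x) = c *\<^sub>R G l x"
  by (rule galerkin_eqI)
    (auto simp: T.scaleR T_galerkin intro: subspace_scale[OF subspace_X] galerkin_in)

lemma galerkin_galerkin: "G j (G k x) = G (min j k) x"
proof (cases "j \<le> k")
  case True
  then have "G j (G k x) = G j x"
    using X_mono by (intro galerkin_eqI) (auto simp: galerkin_in T_galerkin subset_eq)
  then show ?thesis
    using True by (simp add: min_def)
next
  case False
  then show ?thesis
    using galerkin_fixed[of "G k x" j] galerkin_in[of k x] X_mono[of k j] by (auto simp: min_def)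
qed

lemma T_galerkin_sym: "T (G l x) \<bullet> y = T x \<bullet> G l y"
  using T_galerkin[OF galerkin_in, of l y x] T_galerkin[OF galerkin_in, of l x y]
  by (metis T_sym)

lemma norm_galerkin_le_stability: "norm (G l x) \<le> onorm T / \<beta> * norm x"
proof -
  let ?t = "compression T (X l) (G l x)"
  have "?t = orth_proj (X l) (T x)"
    unfolding compression_def
    by (rule orth_proj_eqI[OF subspace_X orth_proj_in[OF fin_dim_X]])
      (simp add: T_galerkin inner_orth_proj[OF fin_dim_X])
  then have "norm ?t \<le> onorm T * norm x"
    using norm_orth_proj_le[OF fin_dim_X, of l "T x"] onorm[OF bounded_linear_T, of x] by simp
  then have "\<beta> * norm (G l x) \<le> onorm T * norm x"
    using compression_X_ge[OF galerkin_in, of l x] by linarith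
  then show ?thesis
    using inf_sup_pos by (simp add: field_simps)
qed

lemma bounded_linear_galerkin: "bounded_linear (G l)"
  by (rule bounded_linear_intro[where K = "onorm T / \<beta>"])
    (use norm_galerkin_le_stability in \<open>auto simp: galerkin_add galerkin_scaleR mult.commute\<close>)

sublocale G: bounded_linear "G l" for l
  by (rule bounded_linear_galerkin)

lemma bdd_above_onorm_galerkin: "bdd_above (range (\<lambda>l. onorm (G l)))"
  by (intro bdd_aboveI2[where M = "onorm T / \<beta>"] onorm_bound norm_galerkin_le_stability)
    (use inf_sup_pos onorm_pos_le[OF bounded_linear_T] in auto)

lemma norm_galerkin_le: "norm (G l x) \<le> K * norm x"
proof -
  have "onorm (G l) \<le> K"
    unfolding galerkin_const_def by (intro cSUP_upper bdd_above_onorm_galerkin) simp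
  then have "onorm (G l) * norm x \<le> K * norm x"
    by (intro mult_right_mono) auto
  then show ?thesis
    using onorm[OF bounded_linear_galerkin, of l x] by linarith
qed

lemma K_ge_1: "K \<ge> 1"
proof -
  obtain l where "X l \<noteq> {0}"
    using X_nontrivial by blast
  then obtain x where "x \<in> X l" "norm x = 1"
    using unit_vector_in_subspace[OF subspace_X] by blast
  then show ?thesis
    using norm_galerkin_le[of l x] by (simp add: galerkin_fixed)
qed

lemma K_mult_norm_nonneg: "0 \<le> K * norm x"
  using K_ge_1 by simp

text \<open>By symmetry of \<open>T\<close>, the map \<open>T x \<mapsto> T (G\<^sub>l x)\<close> is the adjoint of \<open>G\<^sub>l\<close>, so it has the
  same norm.\<close>
lemma norm_T_galerkin_le: "norm (T (G l x)) \<le> K * norm (T x)"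
proof -
  let ?q = "T (G l x)"
  have "norm ?q * norm ?q = T x \<bullet> G l ?q"
    using T_galerkin_sym[of l x ?q] by (simp add: power2_norm_eq_inner[symmetric] power2_eq_square)
  also have "\<dots> \<le> norm (T x) * (K * norm ?q)"
    using norm_cauchy_schwarz[of "T x" "G l ?q"] norm_galerkin_le[of l ?q]
    by (smt (verit) mult_left_mono norm_ge_zero)
  finally have "norm ?q * norm ?q \<le> (K * norm (T x)) * norm ?q"
    by (simp add: algebra_simps)
  then show ?thesis
    using K_ge_1 by (cases "norm ?q = 0") (auto simp: mult_le_cancel_right)
qed

section \<open>Detail spaces\<close>

lemma detail_space_eq: "Y j = range (D j)"
  by (simp add: detail_space_def D_def)

lemma linear_D: "linear (D j)"
  by (rule linearI) (auto simp: D_def galerkin_add galerkin_scaleR algebra_simps)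

sublocale D: linear "D j" for j
  by (rule linear_D)

lemma galerkin_D: "G m (D j x) = (if j \<le> m then D j x else 0)"
  by (auto simp: D_def G.diff galerkin_galerkin min_def G.zero)

lemma D_D: "D j (D k x) = (if j = k then D k x else 0)"
  unfolding D_def[of j] galerkin_D by (cases j) auto

lemma T_D_sym: "T (D j x) \<bullet> y = T x \<bullet> D j y"
  by (simp add: D_def T.diff T_galerkin_sym inner_simps T.zero)

lemma norm_D_le: "norm (D j x) \<le> 2 * K * norm x"
  using norm_galerkin_le[of j x] norm_galerkin_le[of "j - 1" x]
    norm_triangle_ineq4[of "G j x" "G (j - 1) x"] K_mult_norm_nonneg[of x]
  unfolding D_def mult.assoc by (smt (verit) diff_zero)

lemma norm_T_D_le: "norm (T (D j x)) \<le> 2 * K * norm (T x)"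
  using norm_T_galerkin_le[of j x] norm_T_galerkin_le[of "j - 1" x]
    norm_triangle_ineq4[of "T (G j x)" "T (G (j - 1) x)"] K_mult_norm_nonneg[of "T x"]
  unfolding D_def mult.assoc by (smt (verit) T.diff diff_zero)

lemma D_detail: "y \<in> Y k \<Longrightarrow> D j y = (if j = k then y else 0)"
  by (auto simp: detail_space_eq D_D)

lemma galerkin_detail: "y \<in> Y j \<Longrightarrow> G m y = (if j \<le> m then y else 0)"
  by (auto simp: detail_space_eq galerkin_D)

lemma detail_subset_X: "Y j \<subseteq> X j"
proof
  fix y assume "y \<in> Y j"
  then have "G j y = y"
    by (simp add: galerkin_detail)
  then show "y \<in> X j"
    using galerkin_in[of j y] by simp
qed

lemma fin_dim_detail: "fin_dim_subspace (Y j)"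
proof -
  have "D j x = D j (G j x)" for x
    by (simp add: D_def galerkin_galerkin min_def)
  then have "Y j = D j ` X j"
    unfolding detail_space_eq using galerkin_in by blast
  then show ?thesis
    using fin_dim_subspace_linear_image[OF fin_dim_X linear_D] by simp
qed

lemma detail_nontrivial: "\<exists>j. Y j \<noteq> {0}"
proof (rule ccontr)
  assume "\<not> ?thesis"
  then have D0: "D j x = 0" for j x
    by (metis detail_space_eq rangeI singletonD)
  have G0: "G l x = 0" for l x
  proof (induction l)
    case 0
    then show ?case
      using D0[of 0 x] by (simp add: D_def)
  next
    case (Suc l)
    then show ?case
      using D0[of "Suc l" x] by (simp add: D_def)
  qed
  have "X l = {0}" for l
    using galerkin_fixed G0 subspace_0[OF subspace_X] by force
  then show False
    using X_nontrivial by simp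
qed

sublocale detail: symmetric_operator "Y j" "compression T (Y j)" for j
  by (rule symmetric_operator_compression[OF fin_dim_detail bounded_linear_T self_adjoint_T])

text \<open>Testing with \<open>t \<in> X\<^sub>j\<close> is the same as testing with \<open>D\<^sub>j t \<in> Y\<^sub>j\<close>, whose norm is at
  most \<open>2K\<close> times larger; so the local compressions inherit the uniform invertibility.\<close>
lemma compression_detail_ge_beta:
  assumes y: "y \<in> Y j"
  shows "\<beta> / (2 * K) * norm y \<le> norm (compression T (Y j) y)"
proof -
  define t where "t = compression T (X j) y"
  let ?B = "compression T (Y j) y"
  have t: "t \<in> X j"
    by (simp add: t_def compression_def orth_proj_in[OF fin_dim_X])
  have Dt: "D j t \<in> Y j"
    by (simp add: detail_space_eq)
  have "norm t * norm t = T y \<bullet> t"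
    using inner_compression[OF fin_dim_X t, of T y]
    by (simp add: t_def power2_norm_eq_inner[symmetric] power2_eq_square)
  also have "\<dots> = T y \<bullet> D j t"
    using T_D_sym[of j y t] y by (simp add: D_detail)
  also have "\<dots> = ?B \<bullet> D j t"
    using inner_compression[OF fin_dim_detail Dt] by simp
  also have "\<dots> \<le> norm ?B * (2 * K * norm t)"
    using norm_cauchy_schwarz[of ?B "D j t"] norm_D_le[of j t]
    by (smt (verit) mult_left_mono norm_ge_zero)
  finally have "norm t * norm t \<le> (2 * K * norm ?B) * norm t"
    by (simp add: algebra_simps)
  then have "norm t \<le> 2 * K * norm ?B"
    using K_ge_1 by (cases "norm t = 0") (auto simp: mult_le_cancel_right)
  moreover have "\<beta> * norm y \<le> norm t"
    unfolding t_def using compression_X_ge detail_subset_X y by blast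
  ultimately show ?thesis
    using K_ge_1 by (simp add: field_simps)
qed

lemma beta_over_2K_pos: "\<beta> / (2 * K) > 0"
  using inf_sup_pos K_ge_1 by simp

lemma mu_pos: "\<mu> > 0"
  using inf_sup_const_ge[OF detail.symmetric_operator_axioms beta_over_2K_pos
      compression_detail_ge_beta detail_nontrivial] beta_over_2K_pos
  by linarith

lemma compression_detail_ge:
  assumes "y \<in> Y j"
  shows "\<mu> * norm y \<le> norm (compression T (Y j) y)"
  using detail.symmetric_operator_axioms
    detail.bij_betw_if_bounded_below[OF beta_over_2K_pos compression_detail_ge_beta] assms
  by (rule inf_sup_const_le)

section \<open>Finite windows\<close>

lemma D_sum_details:
  assumes "finite I" "\<And>j. j \<in> I \<Longrightarrow> y j \<in> Y j" "k \<in> I"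
  shows "D k (\<Sum>j\<in>I. y j) = y k"
proof -
  have "D k (\<Sum>j\<in>I. y j) = (\<Sum>j\<in>I. if k = j then y j else 0)"
    unfolding D.sum using assms(2) by (intro sum.cong) (auto simp: D_detail)
  then show ?thesis
    using assms(1,3) by simp
qed

lemma galerkin_sum_D:
  assumes "finite J"
  shows "G m (\<Sum>j\<in>J. c j *\<^sub>R D j (x j)) = (\<Sum>j\<in>{j\<in>J. j \<le> m}. c j *\<^sub>R D j (x j))"
proof -
  have "G m (\<Sum>j\<in>J. c j *\<^sub>R D j (x j)) = (\<Sum>j\<in>J. if j \<le> m then c j *\<^sub>R D j (x j) else 0)"
    unfolding G.sum by (intro sum.cong) (auto simp: galerkin_scaleR galerkin_D)
  then show ?thesis
    using assms by (simp add: sum.inter_filter)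
qed

lemma norm_sum_details_le:
  assumes I: "finite I" "I \<noteq> {}" and y: "\<And>j. j \<in> I \<Longrightarrow> y j \<in> Y j"
  shows "(norm (\<Sum>j\<in>I. y j))\<^sup>2 \<le> window_const K (card I) * (\<Sum>j\<in>I. (norm (y j))\<^sup>2)"
proof -
  have "(norm (\<Sum>j\<in>I. D j (y j)))\<^sup>2 \<le> window_const K (card I) * (\<Sum>j\<in>I. (norm (D j (y j)))\<^sup>2)"
  proof (rule norm_sum_le_window_const[OF K_ge_1 _ I])
    fix J :: "nat set" and m and c :: "nat \<Rightarrow> real"
    assume "finite J"
    then show "norm (\<Sum>j\<in>{j\<in>J. j \<le> m}. c j *\<^sub>R D j (y j)) \<le> K * norm (\<Sum>j\<in>J. c j *\<^sub>R D j (y j))"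
      using norm_galerkin_le by (simp flip: galerkin_sum_D)
  qed
  moreover have "D j (y j) = y j" if "j \<in> I" for j
    using D_detail[OF y[OF that]] by simp
  ultimately show ?thesis
    by simp
qed

lemma norm_sum_dual_details_le:
  assumes I: "finite I" "I \<noteq> {}"
  shows "(norm (\<Sum>j\<in>I. T (D j (x j))))\<^sup>2 \<le> window_const K (card I) * (\<Sum>j\<in>I. (norm (T (D j (x j))))\<^sup>2)"
proof (rule norm_sum_le_window_const[OF K_ge_1 _ I])
  fix J :: "nat set" and m and c :: "nat \<Rightarrow> real"
  assume J: "finite J"
  have T: "T (\<Sum>j\<in>A. c j *\<^sub>R D j (x j)) = (\<Sum>j\<in>A. c j *\<^sub>R T (D j (x j)))" for A
    by (simp add: T.sum T.scaleR)
  show "norm (\<Sum>j\<in>{j\<in>J. j \<le> m}. c j *\<^sub>R T (D j (x j))) \<le> K * norm (\<Sum>j\<in>J. c j *\<^sub>R T (D j (x j)))"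
    unfolding T[symmetric] galerkin_sum_D[OF J, symmetric] by (rule norm_T_galerkin_le)
qed

text \<open>The lower bound is dual to the upper bound for the adjoint projections \<open>D\<^sub>j\<^sup>*\<close>, whose
  ranges are \<open>T Y\<^sub>j\<close>: with \<open>w = \<Sum>\<^sub>j y\<^sub>j\<close>,
  \<open>\<Sum>\<^sub>j \<parallel>y\<^sub>j\<parallel>\<^sup>2 = \<Sum>\<^sub>j D\<^sub>j w \<bullet> y\<^sub>j = w \<bullet> \<Sum>\<^sub>j D\<^sub>j\<^sup>* y\<^sub>j\<close>. Estimating directly would lose a factor
  \<open>1 / (1 - \<theta>)\<close> at each halving instead of \<open>1 + \<theta>\<close>.\<close>
lemma sum_norm_details_le:
  assumes I: "finite I" "I \<noteq> {}" and y: "\<And>j. j \<in> I \<Longrightarrow> y j \<in> Y j"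
  shows "(\<Sum>j\<in>I. (norm (y j))\<^sup>2) \<le> (2 * K)\<^sup>2 * window_const K (card I) * (norm (\<Sum>j\<in>I. y j))\<^sup>2"
proof -
  define w where "w = (\<Sum>j\<in>I. y j)"
  define S where "S = (\<Sum>j\<in>I. (norm (y j))\<^sup>2)"
  define C where "C = window_const K (card I)"
  have C: "C \<ge> 0"
    unfolding C_def by (rule window_const_nonneg[OF K_ge_1])
  have S: "S \<ge> 0"
    unfolding S_def by (intro sum_nonneg) auto
  define x where "x j = inv T (y j)" for j
  have x: "T (x j) = y j" for j
    by (simp add: x_def surj_f_inv_f[OF surj_T])
  \<comment> \<open>\<open>T (D\<^sub>j (x\<^sub>j))\<close> is \<open>D\<^sub>j\<^sup>* y\<^sub>j\<close>.\<close>
  define z where "z = (\<Sum>j\<in>I. T (D j (x j)))"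
  have "z \<bullet> w = (\<Sum>j\<in>I. y j \<bullet> D j w)"
    by (simp add: z_def inner_sum_left T_D_sym x)
  also have "\<dots> = S"
    unfolding S_def w_def using D_sum_details[OF I(1) y] by (simp add: power2_norm_eq_inner)
  finally have "S \<le> norm z * norm w"
    using norm_cauchy_schwarz[of z w] by simp
  then have Szw: "S\<^sup>2 \<le> (norm z)\<^sup>2 * (norm w)\<^sup>2"
    using S power_mono[of S _ 2] by (metis power_mult_distrib)
  have "(norm z)\<^sup>2 \<le> C * (\<Sum>j\<in>I. (norm (T (D j (x j))))\<^sup>2)"
    unfolding z_def C_def by (rule norm_sum_dual_details_le[OF I])
  also have "\<dots> \<le> C * (\<Sum>j\<in>I. (2 * K)\<^sup>2 * (norm (y j))\<^sup>2)"
  proof (intro mult_left_mono sum_mono C)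
    fix j
    have "(norm (T (D j (x j))))\<^sup>2 \<le> (2 * K * norm (y j))\<^sup>2"
      using norm_T_D_le[of j "x j"] by (intro power_mono) (auto simp: x)
    then show "(norm (T (D j (x j))))\<^sup>2 \<le> (2 * K)\<^sup>2 * (norm (y j))\<^sup>2"
      by (simp add: power_mult_distrib)
  qed
  also have "\<dots> = C * (2 * K)\<^sup>2 * S"
    by (simp add: S_def sum_distrib_left[symmetric])
  finally have "(norm z)\<^sup>2 * (norm w)\<^sup>2 \<le> C * (2 * K)\<^sup>2 * S * (norm w)\<^sup>2"
    by (rule mult_right_mono) simp
  also have "\<dots> = ((2 * K)\<^sup>2 * C * (norm w)\<^sup>2) * S"
    by (simp only: mult_ac)
  finally have "S * S \<le> ((2 * K)\<^sup>2 * C * (norm w)\<^sup>2) * S"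
    using Szw by (simp only: power2_eq_square[of S])
  then have "S \<le> (2 * K)\<^sup>2 * C * (norm w)\<^sup>2"
    using S C by (cases "S = 0") (auto simp: mult_le_cancel_right)
  then show ?thesis
    by (simp add: S_def C_def w_def)
qed

lemma local_sign_in: "local_sign T X j v \<in> Y j"
  unfolding local_sign_def by (rule detail.spectral_apply_in)

lemma norm_local_sign_le: "v \<in> Y j \<Longrightarrow> norm (local_sign T X j v) \<le> norm v"
  unfolding local_sign_def by (rule detail.norm_sign_le[OF mu_pos compression_detail_ge])

lemma inner_local_sign_ge:
  assumes "v \<in> Y j"
  shows "\<mu> * (norm v)\<^sup>2 \<le> T v \<bullet> local_sign T X j v"
  using detail.inner_sign_ge[OF mu_pos compression_detail_ge assms]
    inner_compression[OF fin_dim_detail local_sign_in, of T j v v]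
  by (simp add: local_sign_def)

lemma window_sign_sum:
  assumes I: "finite I" and y: "\<And>j. j \<in> I \<Longrightarrow> y j \<in> Y j"
  shows "window_sign T X I (\<Sum>j\<in>I. y j) = (\<Sum>j\<in>I. local_sign T X j (y j))"
  unfolding window_sign_def
proof (rule the_equality)
  fix v
  assume "\<exists>y'. (\<forall>j\<in>I. y' j \<in> Y j) \<and> (\<Sum>j\<in>I. y j) = (\<Sum>j\<in>I. y' j)
    \<and> v = (\<Sum>j\<in>I. local_sign T X j (y' j))"
  then obtain y' where y': "\<And>j. j \<in> I \<Longrightarrow> y' j \<in> Y j" "(\<Sum>j\<in>I. y j) = (\<Sum>j\<in>I. y' j)"
    and v: "v = (\<Sum>j\<in>I. local_sign T X j (y' j))"
    by blast
  have "y' j = y j" if "j \<in> I" for j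
    using D_sum_details[OF I y that] D_sum_details[OF I y'(1) that] y'(2) by simp
  then show "v = (\<Sum>j\<in>I. local_sign T X j (y j))"
    using v by simp
qed (use y in blast)

lemma norm_window_sign_le:
  assumes I: "finite I" "I \<noteq> {}" and y: "\<And>j. j \<in> I \<Longrightarrow> y j \<in> Y j"
  shows "norm (\<Sum>j\<in>I. local_sign T X j (y j)) \<le> 2 * K * window_const K (card I) * norm (\<Sum>j\<in>I. y j)"
proof -
  define C where "C = window_const K (card I)"
  have C: "C \<ge> 0"
    unfolding C_def by (rule window_const_nonneg[OF K_ge_1])
  have "(norm (\<Sum>j\<in>I. local_sign T X j (y j)))\<^sup>2 \<le> C * (\<Sum>j\<in>I. (norm (local_sign T X j (y j)))\<^sup>2)"
    unfolding C_def by (rule norm_sum_details_le[OF I local_sign_in])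
  also have "\<dots> \<le> C * (\<Sum>j\<in>I. (norm (y j))\<^sup>2)"
    using norm_local_sign_le[OF y] by (intro mult_left_mono sum_mono power_mono C) auto
  also have "\<dots> \<le> C * ((2 * K)\<^sup>2 * C * (norm (\<Sum>j\<in>I. y j))\<^sup>2)"
    unfolding C_def by (rule mult_left_mono[OF sum_norm_details_le[OF I y] C[unfolded C_def]])
  also have "\<dots> = (2 * K * C * norm (\<Sum>j\<in>I. y j))\<^sup>2"
    by (simp add: power_mult_distrib power2_eq_square)
  finally show ?thesis
    unfolding C_def[symmetric] by (rule power2_le_imp_le) (use C K_ge_1 in simp)
qed

lemma onorm_window_sign_le:
  assumes I: "finite I" "I \<noteq> {}"
  shows "onorm_on (window_space T X I) (window_sign T X I) \<le> 2 * K * window_const K (card I)"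
  unfolding onorm_on_def
proof (rule cSUP_least)
  have "(\<Sum>j\<in>I. 0) \<in> window_space T X I"
    unfolding window_space_def
    using subspace_0[OF fin_dim_subspace_subspace[OF fin_dim_detail]] by blast
  then show "window_space T X I \<noteq> {}"
    by blast
  fix w assume "w \<in> window_space T X I"
  then obtain y where y: "\<And>j. j \<in> I \<Longrightarrow> y j \<in> Y j" and w: "w = (\<Sum>j\<in>I. y j)"
    by (auto simp: window_space_def)
  have "norm (window_sign T X I w) \<le> 2 * K * window_const K (card I) * norm w"
    using norm_window_sign_le[OF I y] window_sign_sum[OF I(1) y] by (simp add: w)
  then show "norm (window_sign T X I w) / norm w \<le> 2 * K * window_const K (card I)"
    using K_ge_1 window_const_nonneg[OF K_ge_1] by (cases "w = 0") (auto simp: field_simps)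
qed

text \<open>With \<open>w = \<Sum>\<^sub>j y\<^sub>j\<close>, both sides are compared with \<open>T w \<bullet> J w\<close>: the form \<open>T x \<bullet> y\<close> has no
  cross terms between different detail spaces, and \<open>T\<close> and \<open>J\<close> are bounded.\<close>
lemma sum_norm_details_le_window_sign:
  assumes I: "finite I" "I \<noteq> {}" and y: "\<And>j. j \<in> I \<Longrightarrow> y j \<in> Y j"
  shows "\<mu> * (\<Sum>j\<in>I. (norm (y j))\<^sup>2)
    \<le> onorm T * (2 * K * window_const K (card I)) * (norm (\<Sum>j\<in>I. y j))\<^sup>2"
proof -
  define w where "w = (\<Sum>j\<in>I. y j)"
  define v where "v = (\<Sum>j\<in>I. local_sign T X j (y j))"
  have "\<mu> * (\<Sum>j\<in>I. (norm (y j))\<^sup>2) \<le> (\<Sum>j\<in>I. T (y j) \<bullet> local_sign T X j (y j))"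
    unfolding sum_distrib_left by (intro sum_mono inner_local_sign_ge y)
  also have "\<dots> = (\<Sum>j\<in>I. T (y j) \<bullet> v)"
  proof (rule sum.cong)
    fix j assume j: "j \<in> I"
    have "T (y j) \<bullet> v = T (y j) \<bullet> D j v"
      using T_D_sym[of j "y j" v] D_detail[OF y[OF j], of j] by simp
    also have "D j v = local_sign T X j (y j)"
      unfolding v_def by (rule D_sum_details[OF I(1) local_sign_in j])
    finally show "T (y j) \<bullet> local_sign T X j (y j) = T (y j) \<bullet> v"
      by simp
  qed simp
  also have "\<dots> = T w \<bullet> v"
    by (simp add: w_def T.sum inner_sum_left)
  also have "\<dots> \<le> norm (T w) * norm v"
    by (rule norm_cauchy_schwarz)
  also have "\<dots> \<le> (onorm T * norm w) * (2 * K * window_const K (card I) * norm w)"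
    unfolding v_def w_def
    by (intro mult_mono onorm[OF bounded_linear_T] norm_window_sign_le[OF I y]
        mult_nonneg_nonneg onorm_pos_le[OF bounded_linear_T]) auto
  finally show ?thesis
    by (simp add: w_def power2_eq_square mult_ac)
qed

end

section \<open>Growth of the window sign operators\<close>

theorem proposition5p2:
  fixes T :: "'a::{real_inner, complete_space} \<Rightarrow> 'a"
    and X :: "nat \<Rightarrow> 'a set"
    and I :: "nat set"
    and n :: nat
    and K \<mu> :: real
  assumes "bounded_linear T"
    and "self_adjoint T"
    and "bij T"
    and "\<And>l. fin_dim_subspace (X l)"
    and "\<And>l. X l \<subseteq> X (Suc l)"
    and "\<exists>l. X l \<noteq> {0}"
    and "\<And>l. bij_betw (compression T (X l)) (X l) (X l)"
    and "inf_sup_const T X > 0"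
    and "K = galerkin_const T X"
    and "\<mu> = inf_sup_const T (detail_space T X)"
    and "detail_window T X I"
    and "n = card I"
  shows "bdd_above (range (\<lambda>l. onorm (galerkin T (X l)))) \<and>
     onorm_on (window_space T X I) (window_sign T X I)
       \<le> 2 * K * (1 + theta_const K) * real n powr sigma_const K \<and>
     (\<forall>y. (\<forall>j\<in>I. y j \<in> detail_space T X j) \<longrightarrow>
        (\<Sum>j\<in>I. (norm (y j))\<^sup>2)
          \<le> 2 * onorm T * K * (1 + theta_const K) / \<mu> * real n powr sigma_const K * (norm (\<Sum>j\<in>I. y j))\<^sup>2)"
proof -
  interpret galerkin_scale T X
    using assms(1-8) by (intro galerkin_scale.intro bij_is_surj)
  have I: "finite I" "I \<noteq> {}"
    using assms(11) by (auto simp: detail_window_def)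
  have "(\<Sum>j\<in>I. (norm (y j))\<^sup>2)
      \<le> 2 * onorm T * K * (1 + theta_const K) / \<mu> * real n powr sigma_const K * (norm (\<Sum>j\<in>I. y j))\<^sup>2"
    if "\<forall>j\<in>I. y j \<in> detail_space T X j" for y
    using sum_norm_details_le_window_sign[OF I, of y] mu_pos that
    unfolding assms(9,10,12) by (simp add: window_const_def field_simps)
  then show ?thesis
    using bdd_above_onorm_galerkin onorm_window_sign_le[OF I]
    by (simp add: assms(9,12) window_const_def mult.assoc)
qed

end
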